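(* Let $(G_j)_{j\in J}$ be a family of topological groups $G_j$ which are complete (resp., sequentially complete). Then also the small box product $\square_{j\in J}G_j$ is complete (resp., sequentially complete).
   Context: Topological groups are not assumed Hausdorff. A net $(x_\alpha)_{\alpha\in A}$ in a topological group $G$ is a left Cauchy net if for each identity neighbourhood $U\subseteq G$ there is $\gamma\in A$ with $x_\beta^{-1}x_\alpha\in U$ for all $\alpha,\beta\ge\gamma$. $G$ is complete (resp., sequentially complete) if every left Cauchy net (resp., left Cauchy sequence) in $G$ converges. The small box product $\square_{j\in J}G_j$ is the subgroup of $\prod_{j\in J}G_j$ of all $(x_j)_{j\in J}$ with $x_j=e$ for all but finitely many $j$, endowed with the box topology, the group topology having as a basis the sets $\prod_{j\in J}U_j\cap\square_{j\in J}G_j$, where $(U_j)_{j\in J}$ ranges over families of open subsets $U_j\subseteq G_j$ with $e\in U_j$ for all but finitely many $j$. *)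

theory Defs
  imports "HOL-Analysis.Analysis" "HOL-Algebra.Product_Groups"
begin

text \<open>Topological groups are not assumed to be Hausdorff.\<close>

locale topological_group = group G for G (structure) +
  fixes T :: "'a topology"
  assumes topspace_eq: "topspace T = carrier G"
    and continuous_mult: "continuous_map (prod_topology T T) T (\<lambda>(x, y). x \<otimes> y)"
    and continuous_inv: "continuous_map T T (\<lambda>x. inv x)"

definition identity_nbhd :: "('a, 'b) monoid_scheme \<Rightarrow> 'a topology \<Rightarrow> 'a set \<Rightarrow> bool" where
  "identity_nbhd G T U \<longleftrightarrow>
     U \<subseteq> carrier G \<and> (\<exists>V. openin T V \<and> \<one>\<^bsub>G\<^esub> \<in> V \<and> V \<subseteq> U)"

definition directed_set :: "'i set \<Rightarrow> ('i \<Rightarrow> 'i \<Rightarrow> bool) \<Rightarrow> bool" where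
  "directed_set A R \<longleftrightarrow>
     A \<noteq> {} \<and>
     (\<forall>\<alpha>\<in>A. R \<alpha> \<alpha>) \<and>
     (\<forall>\<alpha>\<in>A. \<forall>\<beta>\<in>A. \<forall>\<gamma>\<in>A. R \<alpha> \<beta> \<longrightarrow> R \<beta> \<gamma> \<longrightarrow> R \<alpha> \<gamma>) \<and>
     (\<forall>\<alpha>\<in>A. \<forall>\<beta>\<in>A. \<exists>\<gamma>\<in>A. R \<alpha> \<gamma> \<and> R \<beta> \<gamma>)"

definition net_filter :: "'i set \<Rightarrow> ('i \<Rightarrow> 'i \<Rightarrow> bool) \<Rightarrow> 'i filter" where
  "net_filter A R = (INF \<gamma>\<in>A. principal {\<alpha> \<in> A. R \<gamma> \<alpha>})"

lemma eventually_net_filter: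
  assumes "directed_set A R"
  shows "eventually P (net_filter A R) \<longleftrightarrow> (\<exists>\<gamma>\<in>A. \<forall>\<alpha>\<in>A. R \<gamma> \<alpha> \<longrightarrow> P \<alpha>)"
proof -
  have "eventually P (net_filter A R) \<longleftrightarrow>
      (\<exists>\<gamma>\<in>A. eventually P (principal {\<alpha> \<in> A. R \<gamma> \<alpha>}))"
    unfolding net_filter_def
  proof (rule eventually_INF_base)
    show "A \<noteq> {}" using assms by (simp add: directed_set_def)
    fix a b assume ab: "a \<in> A" "b \<in> A"
    then obtain c where c: "c \<in> A" "R a c" "R b c"
      using assms unfolding directed_set_def by blast
    have "{\<alpha> \<in> A. R c \<alpha>} \<subseteq> {\<alpha> \<in> A. R a \<alpha>} \<inter> {\<alpha> \<in> A. R b \<alpha>}"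
      using assms ab c unfolding directed_set_def by blast
    then show "\<exists>x\<in>A. principal {\<alpha> \<in> A. R x \<alpha>}
        \<le> inf (principal {\<alpha> \<in> A. R a \<alpha>}) (principal {\<alpha> \<in> A. R b \<alpha>})"
      using c by auto
  qed
  then show ?thesis by (auto simp: eventually_principal)
qed

lemma net_filter_nat: "net_filter (UNIV :: nat set) (\<le>) = sequentially"
  by (simp add: net_filter_def at_top_def atLeast_def)

lemma directed_set_nat: "directed_set (UNIV :: nat set) (\<le>)"
  unfolding directed_set_def
proof (intro conjI ballI impI)
  fix m n :: nat
  show "\<exists>k\<in>UNIV. m \<le> k \<and> n \<le> k" by (rule bexI[of _ "max m n"]) simp_all
qed simp_all

definition left_Cauchy_net ::
  "('a, 'b) monoid_scheme \<Rightarrow> 'a topology \<Rightarrow> 'i set \<Rightarrow> ('i \<Rightarrow> 'i \<Rightarrow> bool) \<Rightarrow> ('i \<Rightarrow> 'a) \<Rightarrow> bool" where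
  "left_Cauchy_net G T A R x \<longleftrightarrow>
     directed_set A R \<and> x \<in> A \<rightarrow> carrier G \<and>
     (\<forall>U. identity_nbhd G T U \<longrightarrow>
        (\<exists>\<gamma>\<in>A. \<forall>\<alpha>\<in>A. \<forall>\<beta>\<in>A. R \<gamma> \<alpha> \<longrightarrow> R \<gamma> \<beta> \<longrightarrow>
           inv\<^bsub>G\<^esub> (x \<beta>) \<otimes>\<^bsub>G\<^esub> x \<alpha> \<in> U))"

definition net_convergent ::
  "'a topology \<Rightarrow> 'i set \<Rightarrow> ('i \<Rightarrow> 'i \<Rightarrow> bool) \<Rightarrow> ('i \<Rightarrow> 'a) \<Rightarrow> bool" where
  "net_convergent T A R x \<longleftrightarrow> (\<exists>l. limitin T x l (net_filter A R))"

text \<open>A definition cannot quantify over the type of indices, so completeness is stated for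
  nets whose index set is a directed set of subsets of the group (with an arbitrary preorder).
  By \<open>complete_group_net_convergent\<close> below, every left Cauchy net, with indices of
  any type, then converges, so that nothing is lost.\<close>

definition complete_group :: "('a, 'b) monoid_scheme \<Rightarrow> 'a topology \<Rightarrow> bool" where
  "complete_group G T \<longleftrightarrow>
     (\<forall>(A :: 'a set set) R x. left_Cauchy_net G T A R x \<longrightarrow> net_convergent T A R x)"

definition sequentially_complete_group :: "('a, 'b) monoid_scheme \<Rightarrow> 'a topology \<Rightarrow> bool" where
  "sequentially_complete_group G T \<longleftrightarrow>
     (\<forall>x. left_Cauchy_net G T (UNIV :: nat set) (\<le>) x \<longrightarrow>
          net_convergent T (UNIV :: nat set) (\<le>) x)"

context topological_group
begin

lemma mult_nbhd:
  assumes "openin T W" "x \<in> carrier G" "y \<in> carrier G" "x \<otimes> y \<in> W"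
  obtains U V where "openin T U" "x \<in> U" "openin T V" "y \<in> V"
    "\<And>u v. u \<in> U \<Longrightarrow> v \<in> V \<Longrightarrow> u \<otimes> v \<in> W"
proof -
  let ?S = "{p \<in> topspace (prod_topology T T). (case p of (x, y) \<Rightarrow> x \<otimes> y) \<in> W}"
  have "openin (prod_topology T T) ?S"
    using continuous_mult assms(1) by (rule openin_continuous_map_preimage)
  moreover have "(x, y) \<in> ?S" using assms by (simp add: topspace_eq)
  ultimately have "\<exists>U V. openin T U \<and> openin T V \<and> x \<in> U \<and> y \<in> V \<and> U \<times> V \<subseteq> ?S"
    unfolding openin_prod_topology_alt by (elim allE) (erule mp)
  then obtain U V where UV: "openin T U" "openin T V" "x \<in> U" "y \<in> V" "U \<times> V \<subseteq> ?S"
    by (elim exE conjE) (rule that)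
  have "u \<otimes> v \<in> W" if "u \<in> U" "v \<in> V" for u v
    using subsetD[OF UV(5), of "(u, v)"] that by simp
  then show ?thesis by (rule that[OF UV(1,3,2,4)])
qed

lemma inv_nbhd:
  assumes "openin T W" "x \<in> carrier G" "inv x \<in> W"
  obtains U where "openin T U" "x \<in> U" "\<And>u. u \<in> U \<Longrightarrow> inv u \<in> W"
proof -
  have op: "openin T {x \<in> topspace T. inv x \<in> W}"
    using continuous_inv assms(1) by (rule openin_continuous_map_preimage)
  have "x \<in> {x \<in> topspace T. inv x \<in> W}" using assms(2,3) by (simp add: topspace_eq)
  then show ?thesis by (rule that[OF op]) simp
qed

lemma complete_group_net_convergent:
  fixes A :: "'i set"
  assumes complete: "complete_group G T" and Cauchy: "left_Cauchy_net G T A R x"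
  shows "net_convergent T A R x"
proof -
  have dir: "directed_set A R" and xA: "\<And>\<alpha>. \<alpha> \<in> A \<Longrightarrow> x \<alpha> \<in> carrier G"
    using Cauchy by (auto simp: left_Cauchy_net_def)
  define B where "B = {U. openin T U \<and> \<one> \<in> U}"
  have nbhd: "identity_nbhd G T U" if "U \<in> B" for U
    using that openin_subset[of T U] by (auto simp: B_def identity_nbhd_def topspace_eq)
  have "\<exists>\<gamma>\<in>A. \<forall>\<alpha>\<in>A. \<forall>\<beta>\<in>A. R \<gamma> \<alpha> \<longrightarrow> R \<gamma> \<beta> \<longrightarrow> inv (x \<beta>) \<otimes> x \<alpha> \<in> U"
    if "U \<in> B" for U
    using Cauchy nbhd[OF that] by (auto simp: left_Cauchy_net_def)
  then obtain c where cA: "\<And>U. U \<in> B \<Longrightarrow> c U \<in> A"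
    and c: "\<And>U \<alpha> \<beta>. \<lbrakk>U \<in> B; \<alpha> \<in> A; \<beta> \<in> A; R (c U) \<alpha>; R (c U) \<beta>\<rbrakk> \<Longrightarrow> inv (x \<beta>) \<otimes> x \<alpha> \<in> U"
    by metis
  have refl: "R \<alpha> \<alpha>" if "\<alpha> \<in> A" for \<alpha> using dir that by (simp add: directed_set_def)
  have dirB: "directed_set B (\<lambda>U V. V \<subseteq> U)"
    unfolding directed_set_def
  proof (intro conjI ballI impI)
    have "topspace T \<in> B" using openin_topspace[of T] by (simp add: B_def topspace_eq)
    then show "B \<noteq> {}" by blast
    fix U V assume "U \<in> B" "V \<in> B"
    then have "U \<inter> V \<in> B" by (simp add: B_def openin_Int)
    then show "\<exists>W\<in>B. W \<subseteq> U \<and> W \<subseteq> V" by blast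
  qed auto
  have split: "inv a \<otimes> b = (inv a \<otimes> d) \<otimes> (inv d \<otimes> b)"
    if "a \<in> carrier G" "b \<in> carrier G" "d \<in> carrier G" for a b d
  proof -
    have "d \<otimes> (inv d \<otimes> b) = b" using that m_assoc[of d "inv d" b] by simp
    then show ?thesis using that m_assoc[of "inv a" d "inv d \<otimes> b"] by simp
  qed
  have "left_Cauchy_net G T B (\<lambda>U V. V \<subseteq> U) (\<lambda>U. x (c U))"
    unfolding left_Cauchy_net_def
  proof (intro conjI allI impI)
    show "(\<lambda>U. x (c U)) \<in> B \<rightarrow> carrier G" using cA xA by blast
    fix U assume "identity_nbhd G T U"
    then obtain V where V: "openin T V" "\<one> \<in> V" "V \<subseteq> U" by (auto simp: identity_nbhd_def)
    obtain W1 W2 where W: "openin T W1" "\<one> \<in> W1" "openin T W2" "\<one> \<in> W2"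
      "\<And>u v. u \<in> W1 \<Longrightarrow> v \<in> W2 \<Longrightarrow> u \<otimes> v \<in> V"
      by (rule mult_nbhd[OF V(1) one_closed one_closed]) (simp_all add: V(2))
    have WB: "W1 \<inter> W2 \<in> B" using W by (simp add: B_def openin_Int)
    moreover have "inv (x (c Q)) \<otimes> x (c P) \<in> U"
      if P: "P \<in> B" "P \<subseteq> W1 \<inter> W2" and Q: "Q \<in> B" "Q \<subseteq> W1 \<inter> W2" for P Q
    proof -
      obtain d where d: "d \<in> A" "R (c P) d" "R (c Q) d"
        using dir cA P Q unfolding directed_set_def by meson
      have "inv (x (c Q)) \<otimes> x d \<in> W1" "inv (x d) \<otimes> x (c P) \<in> W2"
        using c[OF Q(1) d(1) cA[OF Q(1)] d(3) refl[OF cA[OF Q(1)]]]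
          c[OF P(1) cA[OF P(1)] d(1) refl[OF cA[OF P(1)]] d(2)] P(2) Q(2) by blast+
      then show ?thesis
        using W(5) V(3) split[OF xA[OF cA[OF Q(1)]] xA[OF cA[OF P(1)]] xA[OF d(1)]]
        by (metis subsetD)
    qed
    ultimately show "\<exists>\<gamma>\<in>B. \<forall>\<alpha>\<in>B. \<forall>\<beta>\<in>B. \<alpha> \<subseteq> \<gamma> \<longrightarrow> \<beta> \<subseteq> \<gamma> \<longrightarrow>
        inv x (c \<beta>) \<otimes> x (c \<alpha>) \<in> U" by blast
  qed (rule dirB)
  then have "net_convergent T B (\<lambda>U V. V \<subseteq> U) (\<lambda>U. x (c U))"
    using complete by (simp add: complete_group_def)
  then obtain l where l: "l \<in> carrier G"
    and lim: "\<And>U. openin T U \<Longrightarrow> l \<in> U \<Longrightarrow> \<exists>P\<in>B. \<forall>Q\<in>B. Q \<subseteq> P \<longrightarrow> x (c Q) \<in> U"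
    by (auto simp: net_convergent_def limitin_def eventually_net_filter[OF dirB] topspace_eq)
  have "\<exists>\<gamma>\<in>A. \<forall>\<alpha>\<in>A. R \<gamma> \<alpha> \<longrightarrow> x \<alpha> \<in> U" if U: "openin T U" "l \<in> U" for U
  proof -
    obtain V1 V2 where V: "openin T V1" "l \<in> V1" "openin T V2" "\<one> \<in> V2"
      "\<And>u v. u \<in> V1 \<Longrightarrow> v \<in> V2 \<Longrightarrow> u \<otimes> v \<in> U"
      by (rule mult_nbhd[OF U(1) l one_closed]) (simp_all add: U(2) l)
    obtain P where P: "P \<in> B" "\<And>Q. Q \<in> B \<Longrightarrow> Q \<subseteq> P \<Longrightarrow> x (c Q) \<in> V1"
      using lim[OF V(1,2)] by blast
    define Q where "Q = P \<inter> V2"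
    have Q: "Q \<in> B" "Q \<subseteq> P" "Q \<subseteq> V2" using P(1) V by (auto simp: Q_def B_def)
    have "x \<alpha> \<in> U" if \<alpha>: "\<alpha> \<in> A" "R (c Q) \<alpha>" for \<alpha>
    proof -
      have "inv (x (c Q)) \<otimes> x \<alpha> \<in> V2"
        using c[OF Q(1) \<alpha>(1) cA[OF Q(1)] \<alpha>(2) refl[OF cA[OF Q(1)]]] Q(3) by blast
      then have "x (c Q) \<otimes> (inv (x (c Q)) \<otimes> x \<alpha>) \<in> U" using V(5) P(2) Q by blast
      moreover have "x (c Q) \<otimes> (inv (x (c Q)) \<otimes> x \<alpha>) = x \<alpha>"
        using xA[OF cA[OF Q(1)]] xA[OF \<alpha>(1)]
          m_assoc[of "x (c Q)" "inv (x (c Q))" "x \<alpha>"] by simp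
      ultimately show ?thesis by simp
    qed
    then show ?thesis using cA[OF Q(1)] by blast
  qed
  then have "limitin T x l (net_filter A R)"
    unfolding limitin_def eventually_net_filter[OF dir] topspace_eq using l by simp
  then show ?thesis unfolding net_convergent_def ..
qed

end

text \<open>The underlying group of the small box product is \<^const>\<open>sum_group\<close>; its elements
  are extensional functions on \<open>J\<close>.\<close>

definition small_box ::
  "'j set \<Rightarrow> ('j \<Rightarrow> ('a, 'b) monoid_scheme) \<Rightarrow> ('j \<Rightarrow> 'a topology) \<Rightarrow> ('j \<Rightarrow> 'a) set \<Rightarrow> bool" where
  "small_box J G T B \<longleftrightarrow>
     (\<exists>U. (\<forall>j\<in>J. openin (T j) (U j)) \<and> finite {j \<in> J. \<one>\<^bsub>G j\<^esub> \<notin> U j} \<and>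
          B = (\<Pi>\<^sub>E j\<in>J. U j) \<inter> carrier (sum_group J G))"

definition small_box_topology ::
  "'j set \<Rightarrow> ('j \<Rightarrow> ('a, 'b) monoid_scheme) \<Rightarrow> ('j \<Rightarrow> 'a topology) \<Rightarrow> ('j \<Rightarrow> 'a) topology" where
  "small_box_topology J G T = topology (arbitrary union_of small_box J G T)"

lemma openin_small_box_topology:
  "openin (small_box_topology J G T) = arbitrary union_of small_box J G T"
proof -
  have "small_box J G T (S \<inter> S')" if S: "small_box J G T S" "small_box J G T S'" for S S'
  proof -
    obtain U where
      U: "\<forall>j\<in>J. openin (T j) (U j)" "finite {j \<in> J. \<one>\<^bsub>G j\<^esub> \<notin> U j}"
         "S = (\<Pi>\<^sub>E j\<in>J. U j) \<inter> carrier (sum_group J G)"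
      using S(1) unfolding small_box_def by (elim exE conjE) (rule that; assumption)
    obtain V where
      V: "\<forall>j\<in>J. openin (T j) (V j)" "finite {j \<in> J. \<one>\<^bsub>G j\<^esub> \<notin> V j}"
         "S' = (\<Pi>\<^sub>E j\<in>J. V j) \<inter> carrier (sum_group J G)"
      using S(2) unfolding small_box_def by (elim exE conjE) (rule that; assumption)
    have "{j \<in> J. \<one>\<^bsub>G j\<^esub> \<notin> U j \<inter> V j} = {j \<in> J. \<one>\<^bsub>G j\<^esub> \<notin> U j} \<union> {j \<in> J. \<one>\<^bsub>G j\<^esub> \<notin> V j}"
      by blast
    then have "finite {j \<in> J. \<one>\<^bsub>G j\<^esub> \<notin> U j \<inter> V j}" using U(2) V(2) by simp
    moreover have "\<forall>j\<in>J. openin (T j) (U j \<inter> V j)" using U(1) V(1) by blast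
    moreover have "S \<inter> S' = (\<Pi>\<^sub>E j\<in>J. U j \<inter> V j) \<inter> carrier (sum_group J G)"
      unfolding U(3) V(3) by (auto simp: PiE_iff)
    ultimately show ?thesis
      unfolding small_box_def by (intro exI[of _ "\<lambda>j. U j \<inter> V j"] conjI)
  qed
  then have "istopology (arbitrary union_of small_box J G T)" by (rule istopology_base)
  then show ?thesis
    unfolding small_box_topology_def by (rule topology_inverse')
qed

lemma openin_small_box_topology_iff:
  "openin (small_box_topology J G T) S \<longleftrightarrow>
     (\<forall>x\<in>S. \<exists>B. small_box J G T B \<and> x \<in> B \<and> B \<subseteq> S)"
  unfolding openin_small_box_topology arbitrary_union_of_alt ..

lemma openin_small_box_topologyE:
  assumes "openin (small_box_topology J G T) W" "x \<in> W"
  obtains U where "\<forall>j\<in>J. openin (T j) (U j)" "x \<in> (\<Pi>\<^sub>E j\<in>J. U j)"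
    "x \<in> carrier (sum_group J G)" "(\<Pi>\<^sub>E j\<in>J. U j) \<inter> carrier (sum_group J G) \<subseteq> W"
proof -
  obtain B where B: "small_box J G T B" "x \<in> B" "B \<subseteq> W"
    using assms unfolding openin_small_box_topology_iff by blast
  then obtain U where U: "\<forall>j\<in>J. openin (T j) (U j)"
    "B = (\<Pi>\<^sub>E j\<in>J. U j) \<inter> carrier (sum_group J G)"
    unfolding small_box_def by (elim exE conjE) (rule that; assumption)
  show ?thesis by (rule that[OF U(1)]) (use U(2) B in auto)
qed

lemma topological_group_small_box:
  assumes tg: "\<And>j. j \<in> J \<Longrightarrow> topological_group (G j) (T j)"
  shows "topological_group (sum_group J G) (small_box_topology J G T)"
proof -
  let ?S = "sum_group J G" and ?B = "small_box_topology J G T"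
  have grp: "\<And>j. j \<in> J \<Longrightarrow> group (G j)" using tg topological_group.axioms(1) by blast
  have ts: "\<And>j. j \<in> J \<Longrightarrow> topspace (T j) = carrier (G j)"
    using tg topological_group.topspace_eq by blast
  note carr = carrier_sum_group[OF grp]
  interpret S: group ?S using grp by (rule sum_group)
  have box: "small_box J G T ((\<Pi>\<^sub>E j\<in>J. U j) \<inter> carrier ?S)"
    "x \<in> (\<Pi>\<^sub>E j\<in>J. U j) \<inter> carrier ?S"
    if "x \<in> carrier ?S" "\<And>j. j \<in> J \<Longrightarrow> openin (T j) (U j)" "\<And>j. j \<in> J \<Longrightarrow> x j \<in> U j" for x U
  proof -
    have "finite {j \<in> J. x j \<noteq> \<one>\<^bsub>G j\<^esub>}" using that(1) by (simp add: carr)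
    moreover have "{j \<in> J. \<one>\<^bsub>G j\<^esub> \<notin> U j} \<subseteq> {j \<in> J. x j \<noteq> \<one>\<^bsub>G j\<^esub>}" using that(3) by force
    ultimately have "finite {j \<in> J. \<one>\<^bsub>G j\<^esub> \<notin> U j}" by (rule rev_finite_subset)
    then show "small_box J G T ((\<Pi>\<^sub>E j\<in>J. U j) \<inter> carrier ?S)"
      unfolding small_box_def by (intro exI[of _ U] conjI ballI that(2) refl)
    show "x \<in> (\<Pi>\<^sub>E j\<in>J. U j) \<inter> carrier ?S" using that by (auto simp: carr PiE_iff)
  qed
  have small_open: "openin ?B S" if "small_box J G T S" for S
    unfolding openin_small_box_topology_iff by (intro ballI exI[of _ S] conjI that order_refl)
  have top: "topspace ?B = carrier ?S"
  proof
    show "topspace ?B \<subseteq> carrier ?S"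
    proof
      fix x assume "x \<in> topspace ?B"
      then show "x \<in> carrier ?S"
        by (rule openin_small_box_topologyE[OF openin_topspace])
    qed
    have "openin ?B (carrier ?S)"
      unfolding openin_small_box_topology_iff
    proof
      fix x assume x: "x \<in> carrier ?S"
      let ?M = "(\<Pi>\<^sub>E j\<in>J. topspace (T j)) \<inter> carrier ?S"
      have xT: "x j \<in> topspace (T j)" if "j \<in> J" for j
        using x that by (auto simp: carr PiE_iff ts)
      have "small_box J G T ?M" by (rule box(1)[OF x]) (simp, erule xT)
      moreover have "x \<in> ?M" by (rule box(2)[OF x]) (simp, erule xT)
      ultimately show "\<exists>B. small_box J G T B \<and> x \<in> B \<and> B \<subseteq> carrier ?S"
        by (intro exI[of _ ?M] conjI) auto
    qed
    then show "carrier ?S \<subseteq> topspace ?B" by (rule openin_subset)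
  qed
  show ?thesis
  proof
    show "topspace ?B = carrier ?S" by (rule top)
    have mult: "openin (prod_topology ?B ?B)
        {p \<in> topspace (prod_topology ?B ?B). (case p of (x, y) \<Rightarrow> x \<otimes>\<^bsub>?S\<^esub> y) \<in> W}" (is "openin _ ?P")
      if W: "openin ?B W" for W
      unfolding openin_prod_topology_alt
    proof (intro allI impI)
      fix x y assume "(x, y) \<in> ?P"
      then have x: "x \<in> carrier ?S" and y: "y \<in> carrier ?S" and xy: "x \<otimes>\<^bsub>?S\<^esub> y \<in> W"
        by (auto simp: top)
      obtain U where U: "\<forall>j\<in>J. openin (T j) (U j)"
        "x \<otimes>\<^bsub>?S\<^esub> y \<in> (\<Pi>\<^sub>E j\<in>J. U j)" "x \<otimes>\<^bsub>?S\<^esub> y \<in> carrier ?S"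
        "(\<Pi>\<^sub>E j\<in>J. U j) \<inter> carrier ?S \<subseteq> W"
        by (rule openin_small_box_topologyE[OF W xy])
      have "\<exists>V V'. openin (T j) V \<and> x j \<in> V \<and> openin (T j) V' \<and> y j \<in> V' \<and>
          (\<forall>u\<in>V. \<forall>v\<in>V'. u \<otimes>\<^bsub>G j\<^esub> v \<in> U j)" if j: "j \<in> J" for j
      proof -
        have "x j \<in> carrier (G j)" "y j \<in> carrier (G j)" "x j \<otimes>\<^bsub>G j\<^esub> y j \<in> U j"
          using x y U(2) j by (auto simp: carr PiE_iff)
        then show ?thesis
          using topological_group.mult_nbhd[OF tg[OF j], of "U j" "x j" "y j"] U(1) j by metis
      qed
      then have "\<forall>j\<in>J. \<exists>V V'. openin (T j) V \<and> x j \<in> V \<and> openin (T j) V' \<and> y j \<in> V' \<and>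
          (\<forall>u\<in>V. \<forall>v\<in>V'. u \<otimes>\<^bsub>G j\<^esub> v \<in> U j)" by (rule ballI)
      from bchoice[OF this] obtain V where
        "\<forall>j\<in>J. \<exists>V'. openin (T j) (V j) \<and> x j \<in> V j \<and> openin (T j) V' \<and> y j \<in> V' \<and>
          (\<forall>u\<in>V j. \<forall>v\<in>V'. u \<otimes>\<^bsub>G j\<^esub> v \<in> U j)" ..
      from bchoice[OF this] obtain V' where
        "\<forall>j\<in>J. openin (T j) (V j) \<and> x j \<in> V j \<and> openin (T j) (V' j) \<and> y j \<in> V' j \<and>
          (\<forall>u\<in>V j. \<forall>v\<in>V' j. u \<otimes>\<^bsub>G j\<^esub> v \<in> U j)" ..
      then have V: "\<And>j. j \<in> J \<Longrightarrow> openin (T j) (V j)" "\<And>j. j \<in> J \<Longrightarrow> x j \<in> V j"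
        "\<And>j. j \<in> J \<Longrightarrow> openin (T j) (V' j)" "\<And>j. j \<in> J \<Longrightarrow> y j \<in> V' j"
        "\<And>j u v. \<lbrakk>j \<in> J; u \<in> V j; v \<in> V' j\<rbrakk> \<Longrightarrow> u \<otimes>\<^bsub>G j\<^esub> v \<in> U j"
        by simp_all
      let ?M = "(\<Pi>\<^sub>E j\<in>J. V j) \<inter> carrier ?S" and ?N = "(\<Pi>\<^sub>E j\<in>J. V' j) \<inter> carrier ?S"
      have "?M \<times> ?N \<subseteq> ?P"
      proof clarify
        fix u v assume uv: "u \<in> PiE J V" "u \<in> carrier ?S" "v \<in> PiE J V'" "v \<in> carrier ?S"
        then have "u \<otimes>\<^bsub>?S\<^esub> v \<in> (\<Pi>\<^sub>E j\<in>J. U j)" using V(5) by (auto simp: PiE_iff)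
        then have "u \<otimes>\<^bsub>?S\<^esub> v \<in> W" using U(4) S.m_closed[OF uv(2,4)] by blast
        then show "(u, v) \<in> topspace (prod_topology ?B ?B) \<and> u \<otimes>\<^bsub>?S\<^esub> v \<in> W"
          using uv by (simp add: top)
      qed
      moreover have "small_box J G T ?M" by (rule box(1)[OF x]) (erule V(1), erule V(2))
      moreover have "small_box J G T ?N" by (rule box(1)[OF y]) (erule V(3), erule V(4))
      moreover have "x \<in> ?M" by (rule box(2)[OF x]) (erule V(1), erule V(2))
      moreover have "y \<in> ?N" by (rule box(2)[OF y]) (erule V(3), erule V(4))
      ultimately show "\<exists>M N. openin ?B M \<and> openin ?B N \<and> x \<in> M \<and> y \<in> N \<and> M \<times> N \<subseteq> ?P"
        by (intro exI[of _ ?M] exI[of _ ?N] conjI small_open)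
    qed
    show "continuous_map (prod_topology ?B ?B) ?B (\<lambda>(x, y). x \<otimes>\<^bsub>?S\<^esub> y)"
      unfolding continuous_map_def
    proof (intro conjI allI impI)
      show "(\<lambda>(x, y). x \<otimes>\<^bsub>?S\<^esub> y) \<in> topspace (prod_topology ?B ?B) \<rightarrow> topspace ?B"
        by (auto simp only: topspace_prod_topology top mem_Sigma_iff Pi_iff split: prod.split
            intro: S.m_closed)
    qed (rule mult)
    have inv: "openin ?B {x \<in> topspace ?B. inv\<^bsub>?S\<^esub> x \<in> W}" if W: "openin ?B W" for W
      unfolding openin_small_box_topology_iff
    proof
      fix x assume "x \<in> {x \<in> topspace ?B. inv\<^bsub>?S\<^esub> x \<in> W}"
      then have x: "x \<in> carrier ?S" and xW: "inv\<^bsub>?S\<^esub> x \<in> W" by (auto simp: top)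
      obtain U where U: "\<forall>j\<in>J. openin (T j) (U j)"
        "inv\<^bsub>?S\<^esub> x \<in> (\<Pi>\<^sub>E j\<in>J. U j)" "inv\<^bsub>?S\<^esub> x \<in> carrier ?S"
        "(\<Pi>\<^sub>E j\<in>J. U j) \<inter> carrier ?S \<subseteq> W"
        by (rule openin_small_box_topologyE[OF W xW])
      have "\<exists>V. openin (T j) V \<and> x j \<in> V \<and> (\<forall>u\<in>V. inv\<^bsub>G j\<^esub> u \<in> U j)" if j: "j \<in> J" for j
      proof -
        have "x j \<in> carrier (G j)" "inv\<^bsub>G j\<^esub> x j \<in> U j"
        proof -
          have "inv\<^bsub>?S\<^esub> x = (\<lambda>j\<in>J. inv\<^bsub>G j\<^esub> x j)" using grp x by (rule inv_sum_group)
          then show "inv\<^bsub>G j\<^esub> x j \<in> U j" using PiE_mem[OF U(2) j] j by simp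
          show "x j \<in> carrier (G j)" using x j by (auto simp: carr PiE_iff)
        qed
        then show ?thesis
          using topological_group.inv_nbhd[OF tg[OF j], of "U j" "x j"] U(1) j by metis
      qed
      then obtain V where V: "\<And>j. j \<in> J \<Longrightarrow> openin (T j) (V j)" "\<And>j. j \<in> J \<Longrightarrow> x j \<in> V j"
        "\<And>j u. j \<in> J \<Longrightarrow> u \<in> V j \<Longrightarrow> inv\<^bsub>G j\<^esub> u \<in> U j"
        by metis
      let ?M = "(\<Pi>\<^sub>E j\<in>J. V j) \<inter> carrier ?S"
      have "?M \<subseteq> {x \<in> topspace ?B. inv\<^bsub>?S\<^esub> x \<in> W}"
      proof
        fix u assume u: "u \<in> (\<Pi>\<^sub>E j\<in>J. V j) \<inter> carrier ?S"
        then have uS: "u \<in> carrier ?S" by blast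
        have "inv\<^bsub>?S\<^esub> u \<in> (\<Pi>\<^sub>E j\<in>J. U j)"
        proof -
          have "inv\<^bsub>?S\<^esub> u = (\<lambda>j\<in>J. inv\<^bsub>G j\<^esub> u j)" using grp uS by (rule inv_sum_group)
          then show ?thesis using u V(3) by (auto simp: PiE_iff)
        qed
        then have "inv\<^bsub>?S\<^esub> u \<in> W" using U(4) S.inv_closed[OF uS] by blast
        then show "u \<in> {x \<in> topspace ?B. inv\<^bsub>?S\<^esub> x \<in> W}" using uS by (simp only: top) blast
      qed
      moreover have "small_box J G T ?M" by (rule box(1)[OF x]) (erule V(1), erule V(2))
      moreover have "x \<in> ?M" by (rule box(2)[OF x]) (erule V(1), erule V(2))
      ultimately show "\<exists>B. small_box J G T B \<and> x \<in> B \<and> B \<subseteq> {x \<in> topspace ?B. inv\<^bsub>?S\<^esub> x \<in> W}"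
        by (intro exI[of _ ?M] conjI)
    qed
    show "continuous_map ?B ?B (\<lambda>x. inv\<^bsub>?S\<^esub> x)"
      unfolding continuous_map_def
    proof (intro conjI allI impI)
      show "(\<lambda>x. inv\<^bsub>?S\<^esub> x) \<in> topspace ?B \<rightarrow> topspace ?B"
        unfolding top by (rule Pi_I) (rule S.inv_closed)
    qed (rule inv)
  qed
qed

end

(* All but finitely many entries of a single member of a Cauchy net are trivial, so a box-small
   Cauchy condition confines the other members uniformly near the identity outside a finite set
   of coordinates. Hence e is a limit of all but finitely many of the component nets, and a family
   of componentwise limits can be chosen in the small box product. The Cauchy condition holds
   uniformly in the coordinates, so componentwise convergence upgrades to the box topology. *)

theory Submission
  imports Defs
begin

text \<open>No exceptional coordinate occurs, so the box is basic open. Boxes of this kind are the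
  only identity neighbourhoods at which the Cauchy condition on the product is tested below.\<close>

lemma identity_nbhd_small_box:
  assumes tg: "\<And>j. j \<in> J \<Longrightarrow> topological_group (G j) (T j)"
    and N: "\<And>j. j \<in> J \<Longrightarrow> openin (T j) (N j)" "\<And>j. j \<in> J \<Longrightarrow> \<one>\<^bsub>G j\<^esub> \<in> N j"
  shows "identity_nbhd (sum_group J G) (small_box_topology J G T)
           ((\<Pi>\<^sub>E j\<in>J. N j) \<inter> carrier (sum_group J G))"
    (is "identity_nbhd ?S ?B ?M")
proof -
  have grp: "\<And>j. j \<in> J \<Longrightarrow> group (G j)" using tg topological_group.axioms(1) by blast
  interpret S: group ?S using grp by (rule sum_group)
  have "{j \<in> J. \<one>\<^bsub>G j\<^esub> \<notin> N j} = {}" using N(2) by blast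
  then have "finite {j \<in> J. \<one>\<^bsub>G j\<^esub> \<notin> N j}" by (simp only: finite.emptyI)
  then have "small_box J G T ?M"
    unfolding small_box_def using N(1) by (intro exI[of _ N] conjI ballI) auto
  then have "openin ?B ?M" unfolding openin_small_box_topology_iff by blast
  moreover have "\<one>\<^bsub>?S\<^esub> \<in> (\<Pi>\<^sub>E j\<in>J. N j)" using N(2) by (auto simp: PiE_iff)
  then have "\<one>\<^bsub>?S\<^esub> \<in> ?M" using S.one_closed by blast
  ultimately show ?thesis unfolding identity_nbhd_def by blast
qed

text \<open>Multiplication and inversion in \<open>sum_group\<close> are coordinatewise, so one
  quotient lying in a box is a statement about all coordinates at once. The gain is that
  \<open>\<gamma>\<close> is fixed before \<open>j\<close>; the next three lemmas use this with
  different choices of \<open>N\<close>.\<close>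

lemma left_Cauchy_net_small_box_uniform:
  assumes tg: "\<And>j. j \<in> J \<Longrightarrow> topological_group (G j) (T j)"
    and Cauchy: "left_Cauchy_net (sum_group J G) (small_box_topology J G T) A R x"
    and N: "\<And>j. j \<in> J \<Longrightarrow> openin (T j) (N j)" "\<And>j. j \<in> J \<Longrightarrow> \<one>\<^bsub>G j\<^esub> \<in> N j"
  obtains \<gamma> where "\<gamma> \<in> A"
    "\<And>\<alpha> \<beta> j. \<lbrakk>\<alpha> \<in> A; \<beta> \<in> A; R \<gamma> \<alpha>; R \<gamma> \<beta>; j \<in> J\<rbrakk> \<Longrightarrow>
       inv\<^bsub>G j\<^esub> (x \<beta> j) \<otimes>\<^bsub>G j\<^esub> x \<alpha> j \<in> N j"
proof -
  let ?S = "sum_group J G"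
  have grp: "\<And>j. j \<in> J \<Longrightarrow> group (G j)" using tg topological_group.axioms(1) by blast
  have xA: "\<And>\<alpha>. \<alpha> \<in> A \<Longrightarrow> x \<alpha> \<in> carrier ?S" using Cauchy by (auto simp: left_Cauchy_net_def)
  let ?M = "(\<Pi>\<^sub>E j\<in>J. N j) \<inter> carrier ?S"
  have "identity_nbhd ?S (small_box_topology J G T) ?M"
    using tg N by (rule identity_nbhd_small_box)
  then have "\<exists>\<gamma>\<in>A. \<forall>\<alpha>\<in>A. \<forall>\<beta>\<in>A. R \<gamma> \<alpha> \<longrightarrow> R \<gamma> \<beta> \<longrightarrow> inv\<^bsub>?S\<^esub> (x \<beta>) \<otimes>\<^bsub>?S\<^esub> x \<alpha> \<in> ?M"
    using Cauchy unfolding left_Cauchy_net_def by (elim conjE allE) (erule mp)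
  then obtain \<gamma> where \<gamma>: "\<gamma> \<in> A"
    "\<forall>\<alpha>\<in>A. \<forall>\<beta>\<in>A. R \<gamma> \<alpha> \<longrightarrow> R \<gamma> \<beta> \<longrightarrow> inv\<^bsub>?S\<^esub> (x \<beta>) \<otimes>\<^bsub>?S\<^esub> x \<alpha> \<in> ?M" ..
  show ?thesis
  proof (rule that[OF \<gamma>(1)])
    fix \<alpha> \<beta> j assume *: "\<alpha> \<in> A" "\<beta> \<in> A" "R \<gamma> \<alpha>" "R \<gamma> \<beta>" "j \<in> J"
    have "inv\<^bsub>?S\<^esub> (x \<beta>) = (\<lambda>j\<in>J. inv\<^bsub>G j\<^esub> x \<beta> j)"
      using grp xA[OF *(2)] by (rule inv_sum_group)
    then show "inv\<^bsub>G j\<^esub> (x \<beta> j) \<otimes>\<^bsub>G j\<^esub> x \<alpha> j \<in> N j"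
      using PiE_mem[OF IntD1[OF \<gamma>(2)[rule_format, OF *(1-4)]] *(5)] *(5) by simp
  qed
qed

lemma left_Cauchy_net_small_box_component:
  assumes tg: "\<And>j. j \<in> J \<Longrightarrow> topological_group (G j) (T j)"
    and Cauchy: "left_Cauchy_net (sum_group J G) (small_box_topology J G T) A R x"
    and i: "i \<in> J"
  shows "left_Cauchy_net (G i) (T i) A R (\<lambda>\<alpha>. x \<alpha> i)"
  unfolding left_Cauchy_net_def
proof (intro conjI allI impI)
  have grp: "\<And>j. j \<in> J \<Longrightarrow> group (G j)" using tg topological_group.axioms(1) by blast
  show "directed_set A R" using Cauchy by (simp add: left_Cauchy_net_def)
  show "(\<lambda>\<alpha>. x \<alpha> i) \<in> A \<rightarrow> carrier (G i)"
    using Cauchy i by (auto simp: left_Cauchy_net_def carrier_sum_group[OF grp] PiE_iff Pi_iff)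
  fix U assume "identity_nbhd (G i) (T i) U"
  then obtain V where V: "openin (T i) V" "\<one>\<^bsub>G i\<^esub> \<in> V" "V \<subseteq> U"
    by (auto simp: identity_nbhd_def)
  \<comment> \<open>Only coordinate \<open>i\<close> is constrained: the resulting box is the
    preimage of \<open>V\<close> under the projection to \<open>G i\<close>.\<close>
  define N where "N j = (if j = i then V else topspace (T j))" for j
  have N: "openin (T j) (N j)" "\<one>\<^bsub>G j\<^esub> \<in> N j" if "j \<in> J" for j
  proof -
    have "\<one>\<^bsub>G j\<^esub> \<in> topspace (T j)"
      using topological_group.topspace_eq[OF tg[OF that]] group.is_monoid[OF grp[OF that]]
      by (simp add: monoid.one_closed)
    then show "openin (T j) (N j)" "\<one>\<^bsub>G j\<^esub> \<in> N j" using V(1,2) by (simp_all add: N_def)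
  qed
  obtain \<gamma> where "\<gamma> \<in> A" "\<And>\<alpha> \<beta> j. \<lbrakk>\<alpha> \<in> A; \<beta> \<in> A; R \<gamma> \<alpha>; R \<gamma> \<beta>; j \<in> J\<rbrakk> \<Longrightarrow>
      inv\<^bsub>G j\<^esub> (x \<beta> j) \<otimes>\<^bsub>G j\<^esub> x \<alpha> j \<in> N j"
    using left_Cauchy_net_small_box_uniform[where N = N, OF tg Cauchy N] by blast
  then show "\<exists>\<gamma>\<in>A. \<forall>\<alpha>\<in>A. \<forall>\<beta>\<in>A. R \<gamma> \<alpha> \<longrightarrow> R \<gamma> \<beta> \<longrightarrow>
      inv\<^bsub>G i\<^esub> (x \<beta> i) \<otimes>\<^bsub>G i\<^esub> x \<alpha> i \<in> U"
    using i V(3) unfolding N_def by (metis subsetD)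
qed

text \<open>The exceptional coordinates all lie in the finite support of one member
  \<open>x \<gamma>\<close>. Limits need not be unique, so the claim is about the identity being a
  limit rather than about the values of chosen limits.\<close>

lemma left_Cauchy_net_small_box_finite_support:
  assumes tg: "\<And>j. j \<in> J \<Longrightarrow> topological_group (G j) (T j)"
    and Cauchy: "left_Cauchy_net (sum_group J G) (small_box_topology J G T) A R x"
  shows "finite {j \<in> J. \<not> limitin (T j) (\<lambda>\<alpha>. x \<alpha> j) \<one>\<^bsub>G j\<^esub> (net_filter A R)}"
    (is "finite ?I")
proof -
  have grp: "\<And>j. j \<in> J \<Longrightarrow> group (G j)" using tg topological_group.axioms(1) by blast
  note carr = carrier_sum_group[OF grp]
  have one: "\<one>\<^bsub>G j\<^esub> \<in> topspace (T j)" if "j \<in> J" for j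
    using topological_group.topspace_eq[OF tg[OF that]] group.is_monoid[OF grp[OF that]]
    by (simp add: monoid.one_closed)
  have dir: "directed_set A R" and xA: "\<And>\<alpha>. \<alpha> \<in> A \<Longrightarrow> x \<alpha> \<in> carrier (sum_group J G)"
    using Cauchy by (auto simp: left_Cauchy_net_def)
  \<comment> \<open>For \<open>j\<close> in \<open>?I\<close>, \<open>W\<close> witnesses that the
    component net does not converge to the identity; elsewhere the whole space will do.\<close>
  have "\<forall>j\<in>J. \<exists>W. openin (T j) W \<and> \<one>\<^bsub>G j\<^esub> \<in> W \<and>
      (j \<in> ?I \<longrightarrow> \<not> eventually (\<lambda>\<alpha>. x \<alpha> j \<in> W) (net_filter A R))"
    using one openin_topspace unfolding limitin_def by blast
  from bchoice[OF this] obtain W where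
    "\<forall>j\<in>J. openin (T j) (W j) \<and> \<one>\<^bsub>G j\<^esub> \<in> W j \<and>
      (j \<in> ?I \<longrightarrow> \<not> eventually (\<lambda>\<alpha>. x \<alpha> j \<in> W j) (net_filter A R))" ..
  then have W: "\<And>j. j \<in> J \<Longrightarrow> openin (T j) (W j)" "\<And>j. j \<in> J \<Longrightarrow> \<one>\<^bsub>G j\<^esub> \<in> W j"
    "\<And>j. j \<in> ?I \<Longrightarrow> \<not> eventually (\<lambda>\<alpha>. x \<alpha> j \<in> W j) (net_filter A R)"
    by simp_all
  obtain \<gamma> where \<gamma>: "\<gamma> \<in> A" "\<And>\<alpha> \<beta> j. \<lbrakk>\<alpha> \<in> A; \<beta> \<in> A; R \<gamma> \<alpha>; R \<gamma> \<beta>; j \<in> J\<rbrakk> \<Longrightarrow>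
      inv\<^bsub>G j\<^esub> (x \<beta> j) \<otimes>\<^bsub>G j\<^esub> x \<alpha> j \<in> W j"
    using left_Cauchy_net_small_box_uniform[where N = W, OF tg Cauchy W(1,2)] by blast
  have refl: "R \<gamma> \<gamma>" using dir \<gamma>(1) by (simp add: directed_set_def)
  have "?I \<subseteq> {j \<in> J. x \<gamma> j \<noteq> \<one>\<^bsub>G j\<^esub>}"
  proof
    fix j assume j: "j \<in> ?I"
    then have jJ: "j \<in> J" by simp
    interpret group "G j" using jJ by (rule grp)
    have "x \<gamma> j \<noteq> \<one>\<^bsub>G j\<^esub>"
    proof
      assume e: "x \<gamma> j = \<one>\<^bsub>G j\<^esub>"
      \<comment> \<open>Taking \<open>\<beta> = \<gamma>\<close>, where \<open>x \<gamma> j\<close>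
        is trivial, turns the Cauchy quotient into \<open>x \<alpha> j\<close> itself, so the net
        stays in the set chosen to prevent this.\<close>
      have "x \<alpha> j \<in> W j" if "\<alpha> \<in> A" "R \<gamma> \<alpha>" for \<alpha>
        using \<gamma>(2)[OF that(1) \<gamma>(1) that(2) refl jJ] xA[OF that(1)] jJ
        by (simp add: e carr PiE_iff)
      then have "eventually (\<lambda>\<alpha>. x \<alpha> j \<in> W j) (net_filter A R)"
        unfolding eventually_net_filter[OF dir] using \<gamma>(1) by blast
      then show False using W(3)[OF j] by contradiction
    qed
    then show "j \<in> {j \<in> J. x \<gamma> j \<noteq> \<one>\<^bsub>G j\<^esub>}" using jJ by simp
  qed
  moreover have "finite {j \<in> J. x \<gamma> j \<noteq> \<one>\<^bsub>G j\<^esub>}" using xA[OF \<gamma>(1)] by (simp add: carr)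
  ultimately show ?thesis by (rule finite_subset)
qed

text \<open>In each coordinate, \<open>x \<alpha> j\<close> is the product of some
  \<open>x \<beta> j\<close> close to \<open>l j\<close> and a Cauchy quotient close to the
  identity. Only the second factor restricts \<open>\<alpha>\<close>, and it does so uniformly in
  \<open>j\<close>.\<close>

lemma limitin_small_box:
  assumes tg: "\<And>j. j \<in> J \<Longrightarrow> topological_group (G j) (T j)"
    and Cauchy: "left_Cauchy_net (sum_group J G) (small_box_topology J G T) A R x"
    and l: "l \<in> carrier (sum_group J G)"
    and lim: "\<And>j. j \<in> J \<Longrightarrow> limitin (T j) (\<lambda>\<alpha>. x \<alpha> j) (l j) (net_filter A R)"
  shows "limitin (small_box_topology J G T) x l (net_filter A R)"
proof -
  let ?S = "sum_group J G" and ?B = "small_box_topology J G T"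
  have grp: "\<And>j. j \<in> J \<Longrightarrow> group (G j)" using tg topological_group.axioms(1) by blast
  note carr = carrier_sum_group[OF grp]
  have ts: "topspace ?B = carrier ?S"
    using topological_group_small_box[OF tg] by (rule topological_group.topspace_eq)
  have dir: "directed_set A R" and xA: "\<And>\<alpha>. \<alpha> \<in> A \<Longrightarrow> x \<alpha> \<in> carrier ?S"
    using Cauchy by (auto simp: left_Cauchy_net_def)
  have "\<exists>\<gamma>\<in>A. \<forall>\<alpha>\<in>A. R \<gamma> \<alpha> \<longrightarrow> x \<alpha> \<in> W" if W: "openin ?B W" "l \<in> W" for W
  proof -
    obtain U where U: "\<forall>j\<in>J. openin (T j) (U j)" "l \<in> (\<Pi>\<^sub>E j\<in>J. U j)"
      "(\<Pi>\<^sub>E j\<in>J. U j) \<inter> carrier ?S \<subseteq> W"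
      by (rule openin_small_box_topologyE[OF W])
    \<comment> \<open>Continuity of multiplication at the pair of \<open>l j\<close> and the
      identity. \<open>N\<close> contains the identity in every coordinate, even where
      \<open>U j\<close> does not, so the sets \<open>N j\<close> form an admissible box for the
      Cauchy condition.\<close>
    have "\<exists>V N. openin (T j) V \<and> l j \<in> V \<and> openin (T j) N \<and> \<one>\<^bsub>G j\<^esub> \<in> N \<and>
        (\<forall>u\<in>V. \<forall>v\<in>N. u \<otimes>\<^bsub>G j\<^esub> v \<in> U j)" if j: "j \<in> J" for j
    proof -
      interpret topological_group "G j" "T j" using j by (rule tg)
      have "l j \<in> carrier (G j)" "l j \<otimes>\<^bsub>G j\<^esub> \<one>\<^bsub>G j\<^esub> \<in> U j"
        using l U(2) j by (auto simp: carr PiE_iff)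
      then show ?thesis using mult_nbhd[of "U j" "l j" "\<one>\<^bsub>G j\<^esub>"] U(1) j one_closed by metis
    qed
    then have "\<forall>j\<in>J. \<exists>V N. openin (T j) V \<and> l j \<in> V \<and> openin (T j) N \<and> \<one>\<^bsub>G j\<^esub> \<in> N \<and>
        (\<forall>u\<in>V. \<forall>v\<in>N. u \<otimes>\<^bsub>G j\<^esub> v \<in> U j)" by (rule ballI)
    from bchoice[OF this] obtain V where
      "\<forall>j\<in>J. \<exists>N. openin (T j) (V j) \<and> l j \<in> V j \<and> openin (T j) N \<and> \<one>\<^bsub>G j\<^esub> \<in> N \<and>
        (\<forall>u\<in>V j. \<forall>v\<in>N. u \<otimes>\<^bsub>G j\<^esub> v \<in> U j)" ..
    from bchoice[OF this] obtain N where
      "\<forall>j\<in>J. openin (T j) (V j) \<and> l j \<in> V j \<and> openin (T j) (N j) \<and> \<one>\<^bsub>G j\<^esub> \<in> N j \<and>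
        (\<forall>u\<in>V j. \<forall>v\<in>N j. u \<otimes>\<^bsub>G j\<^esub> v \<in> U j)" ..
    then have V: "\<And>j. j \<in> J \<Longrightarrow> openin (T j) (V j)" "\<And>j. j \<in> J \<Longrightarrow> l j \<in> V j"
      and N: "\<And>j. j \<in> J \<Longrightarrow> openin (T j) (N j)" "\<And>j. j \<in> J \<Longrightarrow> \<one>\<^bsub>G j\<^esub> \<in> N j"
      and VN: "\<And>j u v. \<lbrakk>j \<in> J; u \<in> V j; v \<in> N j\<rbrakk> \<Longrightarrow> u \<otimes>\<^bsub>G j\<^esub> v \<in> U j"
      by simp_all
    obtain \<gamma> where \<gamma>: "\<gamma> \<in> A" "\<And>\<alpha> \<beta> j. \<lbrakk>\<alpha> \<in> A; \<beta> \<in> A; R \<gamma> \<alpha>; R \<gamma> \<beta>; j \<in> J\<rbrakk> \<Longrightarrow>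
        inv\<^bsub>G j\<^esub> (x \<beta> j) \<otimes>\<^bsub>G j\<^esub> x \<alpha> j \<in> N j"
      using left_Cauchy_net_small_box_uniform[where N = N, OF tg Cauchy N] by blast
    have "x \<alpha> \<in> W" if \<alpha>: "\<alpha> \<in> A" "R \<gamma> \<alpha>" for \<alpha>
    proof -
      have "x \<alpha> j \<in> U j" if j: "j \<in> J" for j
      proof -
        interpret group "G j" using j by (rule grp)
        have "eventually (\<lambda>\<alpha>. x \<alpha> j \<in> V j) (net_filter A R)"
          using lim[OF j] V[OF j] by (simp add: limitin_def)
        then obtain \<delta> where \<delta>: "\<delta> \<in> A" "\<And>\<beta>. \<beta> \<in> A \<Longrightarrow> R \<delta> \<beta> \<Longrightarrow> x \<beta> j \<in> V j"
          unfolding eventually_net_filter[OF dir] by blast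
        \<comment> \<open>\<open>\<beta>\<close> depends on \<open>j\<close>, but \<open>\<gamma>\<close> does not.\<close>
        obtain \<beta> where \<beta>: "\<beta> \<in> A" "R \<gamma> \<beta>" "R \<delta> \<beta>"
          using dir \<gamma>(1) \<delta>(1) unfolding directed_set_def by meson
        have c: "x \<alpha> j \<in> carrier (G j)" "x \<beta> j \<in> carrier (G j)"
          using xA[OF \<alpha>(1)] xA[OF \<beta>(1)] j by (auto simp: carr PiE_iff)
        have "x \<beta> j \<otimes>\<^bsub>G j\<^esub> (inv\<^bsub>G j\<^esub> (x \<beta> j) \<otimes>\<^bsub>G j\<^esub> x \<alpha> j) \<in> U j"
          by (rule VN[OF j \<delta>(2)[OF \<beta>(1,3)] \<gamma>(2)[OF \<alpha>(1) \<beta>(1) \<alpha>(2) \<beta>(2) j]])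
        then show ?thesis using c m_assoc[of "x \<beta> j" "inv\<^bsub>G j\<^esub> (x \<beta> j)" "x \<alpha> j"] by simp
      qed
      then have "x \<alpha> \<in> (\<Pi>\<^sub>E j\<in>J. U j)" using xA[OF \<alpha>(1)] by (auto simp: carr PiE_iff)
      then show ?thesis using U(3) xA[OF \<alpha>(1)] by blast
    qed
    then show ?thesis using \<gamma>(1) by blast
  qed
  then show ?thesis
    unfolding limitin_def eventually_net_filter[OF dir] ts using l by blast
qed

text \<open>Without the Hausdorff property, arbitrarily chosen componentwise limits could be
  nontrivial in infinitely many coordinates. The choice therefore has to favour the
  identity.\<close>

lemma net_convergent_small_box:
  assumes tg: "\<And>j. j \<in> J \<Longrightarrow> topological_group (G j) (T j)"
    and Cauchy: "left_Cauchy_net (sum_group J G) (small_box_topology J G T) A R x"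
    and conv: "\<And>j. j \<in> J \<Longrightarrow> net_convergent (T j) A R (\<lambda>\<alpha>. x \<alpha> j)"
  shows "net_convergent (small_box_topology J G T) A R x"
proof -
  let ?L = "\<lambda>j. limitin (T j) (\<lambda>\<alpha>. x \<alpha> j)" and ?F = "net_filter A R"
  have grp: "\<And>j. j \<in> J \<Longrightarrow> group (G j)" using tg topological_group.axioms(1) by blast
  \<comment> \<open>Take the identity whenever it is a limit, and any limit otherwise.\<close>
  have "\<exists>a. ?L j a ?F \<and> (?L j \<one>\<^bsub>G j\<^esub> ?F \<longrightarrow> a = \<one>\<^bsub>G j\<^esub>)" if "j \<in> J" for j
    using conv[OF that] unfolding net_convergent_def by blast
  then obtain m where m: "\<And>j. j \<in> J \<Longrightarrow> ?L j (m j) ?F"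
    "\<And>j. j \<in> J \<Longrightarrow> ?L j \<one>\<^bsub>G j\<^esub> ?F \<Longrightarrow> m j = \<one>\<^bsub>G j\<^esub>"
    by metis
  \<comment> \<open>The restriction makes the limit extensional, as elements of
    \<open>sum_group\<close> must be.\<close>
  let ?l = "\<lambda>j\<in>J. m j"
  have "{j \<in> J. ?l j \<noteq> \<one>\<^bsub>G j\<^esub>} \<subseteq> {j \<in> J. \<not> ?L j \<one>\<^bsub>G j\<^esub> ?F}" using m(2) by auto
  then have "finite {j \<in> J. ?l j \<noteq> \<one>\<^bsub>G j\<^esub>}"
    by (rule finite_subset[OF _ left_Cauchy_net_small_box_finite_support[OF tg Cauchy]])
  moreover have "m j \<in> carrier (G j)" if "j \<in> J" for j
    using limitin_topspace[OF m(1)[OF that]] topological_group.topspace_eq[OF tg[OF that]]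
    by simp
  ultimately have l: "?l \<in> carrier (sum_group J G)" by (simp add: carrier_sum_group[OF grp])
  have "?L j (?l j) ?F" if "j \<in> J" for j using m(1)[OF that] that by simp
  with tg Cauchy l have "limitin (small_box_topology J G T) x ?l ?F"
    by (rule limitin_small_box)
  then show ?thesis unfolding net_convergent_def by (intro exI[of _ ?l])
qed

theorem mainTheorem10:
  fixes J :: "'j set"
    and G :: "'j \<Rightarrow> ('a, 'b) monoid_scheme"
    and T :: "'j \<Rightarrow> 'a topology"
  assumes "\<And>j. j \<in> J \<Longrightarrow> topological_group (G j) (T j)"
  shows "((\<forall>j\<in>J. complete_group (G j) (T j)) \<longrightarrow>
            complete_group (sum_group J G) (small_box_topology J G T)) \<and>
         ((\<forall>j\<in>J. sequentially_complete_group (G j) (T j)) \<longrightarrow>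
            sequentially_complete_group (sum_group J G) (small_box_topology J G T))"
proof (intro conjI impI)
  assume complete: "\<forall>j\<in>J. complete_group (G j) (T j)"
  show "complete_group (sum_group J G) (small_box_topology J G T)"
    unfolding complete_group_def
  proof (intro allI impI)
    fix A :: "('j \<Rightarrow> 'a) set set" and R x
    assume Cauchy: "left_Cauchy_net (sum_group J G) (small_box_topology J G T) A R x"
    \<comment> \<open>Here the indices are sets of elements of the product, whereas
      \<open>complete_group (G j) (T j)\<close> speaks of indices that are subsets of the factor;
      \<open>complete_group_net_convergent\<close> bridges the two index types.\<close>
    have "net_convergent (T j) A R (\<lambda>\<alpha>. x \<alpha> j)" if "j \<in> J" for j
      using assms[OF that] bspec[OF complete that]
        left_Cauchy_net_small_box_component[OF assms Cauchy that]
      by (rule topological_group.complete_group_net_convergent)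
    with assms Cauchy show "net_convergent (small_box_topology J G T) A R x"
      by (rule net_convergent_small_box)
  qed
next
  assume complete: "\<forall>j\<in>J. sequentially_complete_group (G j) (T j)"
  show "sequentially_complete_group (sum_group J G) (small_box_topology J G T)"
    unfolding sequentially_complete_group_def
  proof (intro allI impI)
    fix x
    assume Cauchy:
      "left_Cauchy_net (sum_group J G) (small_box_topology J G T) (UNIV :: nat set) (\<le>) x"
    \<comment> \<open>Sequences in the product and in the factors share the index type
      \<open>nat\<close>, so the definition applies directly.\<close>
    have "net_convergent (T j) (UNIV :: nat set) (\<le>) (\<lambda>n. x n j)" if "j \<in> J" for j
      using bspec[OF complete that] left_Cauchy_net_small_box_component[OF assms Cauchy that]
      by (simp add: sequentially_complete_group_def)
    with assms Cauchy show "net_convergent (small_box_topology J G T) (UNIV :: nat set) (\<le>) x"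
      by (rule net_convergent_small_box)
  qed
qed

end
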